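(* Let $R$ be a noncommutative simple ring. Then $R$ is an $n$-generalized commutator ring for all $n\geq 3$, i.e. $R=[R,\ldots,R]_n$ for every integer $n\ge 3$.
   Context: Rings are associative, not necessarily with unity. For $n\ge 2$ and $a_1,\ldots,a_n\in R$ put $[a_1,\ldots,a_n]_n := a_1a_2\cdots a_n - a_na_{n-1}\cdots a_1$. $[R,\ldots,R]_n$ (with $n$ entries) denotes the additive subgroup of $R$ generated by all elements $[a_1,\ldots,a_n]_n$ with $a_i\in R$. A ring $R$ is an $n$-generalized commutator ring if $R=[R,\ldots,R]_n$. *)

theory Defs
  imports Main "HOL-Computational_Algebra.Group_Closure"
begin

text \<open>
  The type class \<^class>\<open>ring\<close> has no unity, so \<^const>\<open>prod_list\<close> is not available.
  The value on the empty list is a dummy.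
\<close>

fun list_product :: "'a::ring list \<Rightarrow> 'a" where
  "list_product [] = 0"
| "list_product [a] = a"
| "list_product (a # b # as) = a * list_product (b # as)"

definition gen_commutator :: "'a::ring list \<Rightarrow> 'a" where
  "gen_commutator as = list_product as - list_product (rev as)"

definition gen_commutator_subgroup :: "'a::ring itself \<Rightarrow> nat \<Rightarrow> 'a set" where
  "gen_commutator_subgroup (T :: 'a itself) n =
     group_closure {gen_commutator as | as :: 'a list. length as = n}"

text \<open>Used for \<open>n \<ge> 2\<close> only.\<close>

definition gen_commutator_ring :: "'a::ring itself \<Rightarrow> nat \<Rightarrow> bool" where
  "gen_commutator_ring (T :: 'a itself) n \<longleftrightarrow> (UNIV :: 'a set) = gen_commutator_subgroup T n"

definition two_sided_ideal :: "'a::ring set \<Rightarrow> bool" where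
  "two_sided_ideal I \<longleftrightarrow>
     0 \<in> I \<and> (\<forall>x\<in>I. \<forall>y\<in>I. x - y \<in> I) \<and> (\<forall>r. \<forall>x\<in>I. r * x \<in> I \<and> x * r \<in> I)"

text \<open>
  Without unity, simplicity includes the requirement that the multiplication is not
  identically zero; this also excludes the zero ring.
\<close>

definition simple_ring :: "'a::ring itself \<Rightarrow> bool" where
  "simple_ring (T :: 'a itself) \<longleftrightarrow>
     (\<exists>x y :: 'a. x * y \<noteq> 0) \<and> (\<forall>I :: 'a set. two_sided_ideal I \<longrightarrow> I = {0} \<or> I = UNIV)"

definition noncommutative_ring :: "'a::ring itself \<Rightarrow> bool" where
  "noncommutative_ring (T :: 'a itself) \<longleftrightarrow> (\<exists>x y :: 'a. x * y \<noteq> y * x)"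

end

theory Submission
  imports Defs
begin

text \<open>
  Let \<open>G\<close> be the additive subgroup generated by the \<open>n\<close>-fold generalized commutators.
  A product of \<open>n + 1\<close> factors becomes an \<open>n\<close>-fold product by merging two neighbouring
  factors; a merged pair keeps its internal order when the \<open>n\<close> entries are reversed.
  Reversing twice, with different pairs merged, therefore permutes the
  factors cyclically modulo \<open>G\<close>: \<open>a b c v \<equiv> c a b v\<close>, where \<open>v\<close> is a product of \<open>n - 2\<close>
  factors (\<open>merged_reversal_cycle\<close>). This is an even permutation of the factors, but since
  blocks may be substituted for \<open>a\<close>, \<open>b\<close>, \<open>c\<close>, odd permutations arise as well; in particular
  \<open>a b c d v \<equiv> a b d c v\<close>, so \<open>a b [c, d] v \<in> G\<close> (\<open>interior_commutator_in_subgroup\<close>).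

  The set of all \<open>x\<close> with \<open>a b x v \<in> G\<close> for all \<open>a\<close>, \<open>b\<close>, \<open>v\<close> is a two-sided ideal, because a
  multiplier on the left of \<open>x\<close> is absorbed by \<open>b\<close> and one on the right by \<open>v\<close>. It contains a
  nonzero commutator, so it is the whole ring, which means that \<open>G\<close> contains every product of
  \<open>n + 1\<close> factors. Since a simple ring is spanned by its products of two factors, it is also
  spanned by its products of \<open>n + 1\<close> factors, and so \<open>G\<close> is everything.
\<close>

lemma list_product_Cons:
  "as \<noteq> [] \<Longrightarrow> list_product (a # as) = a * list_product as"
  by (cases as) simp_all

lemma list_product_append:
  "as \<noteq> [] \<Longrightarrow> bs \<noteq> [] \<Longrightarrow> list_product (as @ bs) = list_product as * list_product bs"
proof (induction as)
  case (Cons a as)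
  then show ?case
    by (cases "as = []") (simp_all add: list_product_Cons mult.assoc)
qed simp

lemma list_product_absorb:
  "list_product (r * a # as) = r * list_product (a # as)"
  by (cases as) (simp_all add: mult.assoc)

lemma gen_commutator_in_subgroup:
  assumes "length as = n"
  shows "gen_commutator as \<in> gen_commutator_subgroup TYPE('a::ring) n"
  unfolding gen_commutator_subgroup_def
  using assms by (auto intro: group_closure.base)

lemma gen_commutator_subgroup_diff:
  assumes "x \<in> gen_commutator_subgroup TYPE('a::ring) n"
    and "y \<in> gen_commutator_subgroup TYPE('a) n"
  shows "x - y \<in> gen_commutator_subgroup TYPE('a) n"
  using assms unfolding gen_commutator_subgroup_def by (rule group_closure.diff)

lemma gen_commutator_subgroup_add:
  assumes "x \<in> gen_commutator_subgroup TYPE('a::ring) n"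
    and "y \<in> gen_commutator_subgroup TYPE('a) n"
  shows "x + y \<in> gen_commutator_subgroup TYPE('a) n"
  using assms unfolding gen_commutator_subgroup_def by (rule group_closure_add)

text \<open>
  With \<open>w\<close> the product of \<open>v\<close> in reverse order, \<open>a (bc) v \<equiv> w (bc) a\<close> and
  \<open>w b (ca) \<equiv> (ca) b v\<close>; the two middle terms are equal by associativity.
\<close>

lemma merged_reversal_cycle:
  fixes a b c :: "'a::ring"
  assumes "length v + 2 = n" and "v \<noteq> []"
  shows "a * b * c * list_product v - c * a * b * list_product v
           \<in> gen_commutator_subgroup TYPE('a) n"
proof -
  let ?G = "gen_commutator_subgroup TYPE('a) n"
  have "gen_commutator (a # b * c # v) \<in> ?G"
    by (rule gen_commutator_in_subgroup) (use assms in simp)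
  moreover have "gen_commutator (rev v @ [b, c * a]) \<in> ?G"
    by (rule gen_commutator_in_subgroup) (use assms in simp)
  ultimately have "gen_commutator (a # b * c # v) + gen_commutator (rev v @ [b, c * a]) \<in> ?G"
    by (rule gen_commutator_subgroup_add)
  moreover have "gen_commutator (a # b * c # v)
      = a * b * c * list_product v - list_product (rev v) * b * c * a"
    using assms by (simp add: gen_commutator_def list_product_Cons list_product_append mult.assoc)
  moreover have "gen_commutator (rev v @ [b, c * a])
      = list_product (rev v) * b * c * a - c * a * b * list_product v"
    using assms by (simp add: gen_commutator_def list_product_Cons list_product_append mult.assoc)
  ultimately show ?thesis
    by simp
qed

text \<open>
  Both \<open>a b c d v\<close> and \<open>a b d c v\<close> are congruent to \<open>c a b d v\<close>: cycle \<open>a\<close>, \<open>b\<close>, \<open>c\<close> in the first,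
  with \<open>d\<close> absorbed by \<open>v\<close>, and \<open>ab\<close>, \<open>d\<close>, \<open>c\<close> in the second.
\<close>

lemma interior_commutator_in_subgroup:
  fixes a b c d :: "'a::ring"
  assumes "length v + 2 = n" and "v \<noteq> []"
  shows "a * b * (c * d - d * c) * list_product v \<in> gen_commutator_subgroup TYPE('a) n"
proof -
  let ?G = "gen_commutator_subgroup TYPE('a) n"
  obtain e es where v: "v = e # es"
    using assms(2) by (cases v) auto
  have "a * b * c * list_product (d * e # es) - c * a * b * list_product (d * e # es) \<in> ?G"
    by (rule merged_reversal_cycle) (use assms v in simp_all)
  moreover have "(a * b) * d * c * list_product v - c * (a * b) * d * list_product v \<in> ?G"
    using assms by (rule merged_reversal_cycle)
  ultimately have "(a * b * c * list_product (d * e # es) - c * a * b * list_product (d * e # es))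
      - ((a * b) * d * c * list_product v - c * (a * b) * d * list_product v) \<in> ?G"
    by (rule gen_commutator_subgroup_diff)
  then show ?thesis
    by (simp add: v list_product_absorb algebra_simps)
qed

lemma simple_ring_ideal_UNIV:
  assumes "simple_ring TYPE('a::ring)"
    and "two_sided_ideal I" and "x \<in> I" and "(x :: 'a) \<noteq> 0"
  shows "I = UNIV"
  using assms unfolding simple_ring_def by blast

lemma simple_ring_spanned_by_products:
  assumes "simple_ring TYPE('a::ring)"
  shows "group_closure {a * b | a b :: 'a. True} = UNIV"
proof -
  let ?S = "group_closure {a * b | a b :: 'a. True}"
  have prod: "a * b \<in> ?S" for a b :: 'a
    by (rule group_closure.base) auto
  have "two_sided_ideal ?S"
    unfolding two_sided_ideal_def using prod by (auto intro: group_closure.diff)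
  moreover obtain a b :: 'a where "a * b \<noteq> 0"
    using assms unfolding simple_ring_def by blast
  ultimately show ?thesis
    using simple_ring_ideal_UNIV[OF assms] prod by blast
qed

text \<open>
  The number of factors can be lowered one at a time: the first factor of a product is a sum of
  products of two factors.
\<close>

lemma simple_ring_subgroup_containing_products:
  fixes X :: "'a::ring set"
  assumes simple: "simple_ring TYPE('a)"
    and diff: "\<And>x y. x \<in> X \<Longrightarrow> y \<in> X \<Longrightarrow> x - y \<in> X"
    and "\<And>as. length as = Suc k \<Longrightarrow> list_product as \<in> X"
  shows "X = UNIV"
  using assms(3)
proof (induction k)
  case 0
  have "x \<in> X" for x
    using 0[of "[x]"] by simp
  then show ?case
    by blast
next
  case (Suc k)
  have shorter: "list_product (x # as) \<in> X" if "length as = k" for x as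
  proof -
    have "x \<in> group_closure {a * b | a b :: 'a. True}"
      using simple_ring_spanned_by_products[OF simple] by blast
    then show ?thesis
    proof (induction x rule: group_closure.induct)
      case (base s)
      \<comment> \<open>The closure also has \<open>0\<close> as a generator, which is itself a product.\<close>
      then have "s = 0 * 0 \<or> (\<exists>a b. s = a * b)"
        by auto
      then obtain a b where "s = a * b"
        by blast
      then have "list_product (s # as) = list_product (a # b # as)"
        by (simp add: list_product_absorb)
      then show ?case
        using Suc.prems[of "a # b # as"] that by simp
    next
      case (diff s t)
      have "list_product ((s - t) # as) = list_product (s # as) - list_product (t # as)"
        by (cases as) (simp_all add: left_diff_distrib)
      then show ?case
        using diff assms(2) by simp
    qed
  qed
  show ?case
    by (rule Suc.IH) (use shorter in \<open>auto simp: length_Suc_conv\<close>)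
qed

text \<open>
  Quantifying over \<open>a\<close>, \<open>b\<close>, \<open>v\<close> inside the set \<open>M\<close> is what makes it an ideal: multiplying \<open>x\<close> on
  either side only changes \<open>b\<close> or the first entry of \<open>v\<close>. By simplicity, one nonzero commutator in
  \<open>M\<close> is enough.
\<close>

lemma simple_ring_products_in_subgroup:
  assumes simple: "simple_ring TYPE('a::ring)"
    and noncomm: "noncommutative_ring TYPE('a)"
    and "length v + 2 = n" and "v \<noteq> []"
  shows "(a :: 'a) * b * x * list_product v \<in> gen_commutator_subgroup TYPE('a) n"
proof -
  let ?G = "gen_commutator_subgroup TYPE('a) n"
  define M :: "'a set" where
    "M = {x. \<forall>a b v. length v + 2 = n \<and> v \<noteq> [] \<longrightarrow> a * b * x * list_product v \<in> ?G}"
  have "two_sided_ideal M"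
    unfolding two_sided_ideal_def
  proof (intro conjI allI ballI)
    show "0 \<in> M"
      by (simp add: M_def gen_commutator_subgroup_def)
  next
    fix x y
    assume "x \<in> M" and "y \<in> M"
    then have "a * b * x * list_product v - a * b * y * list_product v \<in> ?G"
      if "length v + 2 = n" "v \<noteq> []" for a b v
      using that by (simp add: M_def gen_commutator_subgroup_diff)
    then show "x - y \<in> M"
      by (simp add: M_def algebra_simps)
  next
    fix r x
    assume x: "x \<in> M"
    then have "a * (b * r) * x * list_product v \<in> ?G"
      if "length v + 2 = n" "v \<noteq> []" for a b v
      using that by (simp add: M_def)
    then show "r * x \<in> M"
      by (simp add: M_def mult.assoc)
    have "a * b * (x * r) * list_product v \<in> ?G"
      if len: "length v + 2 = n" and "v \<noteq> []" for a b v
    proof -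
      obtain e es where v: "v = e # es"
        using \<open>v \<noteq> []\<close> by (cases v) auto
      have "a * b * x * list_product (r * e # es) \<in> ?G"
        using x len v by (simp add: M_def)
      then show ?thesis
        by (simp add: v list_product_absorb mult.assoc)
    qed
    then show "x * r \<in> M"
      by (simp add: M_def)
  qed
  moreover obtain c d :: 'a where "c * d \<noteq> d * c"
    using noncomm unfolding noncommutative_ring_def by blast
  moreover have "c * d - d * c \<in> M"
    unfolding M_def using interior_commutator_in_subgroup by blast
  ultimately have "M = UNIV"
    by (intro simple_ring_ideal_UNIV[OF simple, of M "c * d - d * c"]) simp_all
  then have "x \<in> M"
    by simp
  then show ?thesis
    using assms(3,4) by (simp add: M_def)
qed

theorem corollary4p13:
  assumes "simple_ring TYPE('a::ring)"
    and "noncommutative_ring TYPE('a)"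
  shows "\<forall>n\<ge>3. gen_commutator_ring TYPE('a) n"
proof (intro allI impI)
  fix n :: nat
  assume n: "n \<ge> 3"
  have "list_product as \<in> gen_commutator_subgroup TYPE('a) n"
    if as: "length as = Suc n" for as :: "'a list"
  proof -
    obtain m where m: "n = Suc (Suc (Suc m))"
      using n by (auto simp: numeral_3_eq_3 dest: le_Suc_ex)
    obtain a b x v where v: "as = a # b # x # v" "length v + 2 = n" "v \<noteq> []"
      using as unfolding m by (auto simp: length_Suc_conv)
    then have "list_product as = a * b * x * list_product v"
      by (simp add: list_product_Cons mult.assoc)
    then show ?thesis
      using simple_ring_products_in_subgroup[OF assms v(2,3)] by simp
  qed
  with assms(1) gen_commutator_subgroup_diff
  have "gen_commutator_subgroup TYPE('a) n = UNIV"
    by (rule simple_ring_subgroup_containing_products)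
  then show "gen_commutator_ring TYPE('a) n"
    by (simp add: gen_commutator_ring_def)
qed

end
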